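(* Let $f:\mathbb{R}^d\to\mathbb{R}$ be twice differentiable (not necessarily convex), let $r:\mathbb{R}^d\to\mathbb{R}\cup\{+\infty\}$ be convex and proximable, and let $F=f+r$. Suppose: (1) (exactly sparse gradients) $\|\nabla f(x)\|_0\le s_{\mathrm{exact}}$ for all $x\in\mathbb{R}^d$; (2) (weakly sparse Hessian) there is a constant $H$ with $\|\nabla^2 f(x)\|_1\le H$ for all $x\in\mathbb{R}^d$; (3) the solution set $\{x^\star:F(x^\star)=F^\star\}$ is non-empty, where $F^\star=\min_xF(x)$, and $\|\nabla f(x)-\nabla f(y)\|_2\le L\|x-y\|_2$ for all $x,y\in\mathbb{R}^d$; (4) the oracle noise satisfies $|\xi|\le\sigma$ at every call. Run ZORO with $s\ge s_{\mathrm{exact}}$ and $\alpha=\frac1L$, and let $e_0=F(x_0)-F^\star$. Then for any $\varepsilon>b_5\sqrt{\sigma H}$, ZORO finds an $\varepsilon$-stationary solution (i.e. some iterate is $\varepsilon$-stationary) in $$\frac{12b_1Le_0\,s\log(d)}{\left(\varepsilon-b_5\sqrt{\sigma H}\right)^2}$$ queries, with probability (at least) $1-2(s/d)^{b_2s}$.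
   Context: Notation: $\|\cdot\|_0$ counts nonzero entries; $\|\cdot\|_1$ is the entry-wise $\ell_1$ norm (for vectors and matrices); $[v]_{(s)}$ is the best $s$-sparse approximation of $v$ in $\ell_2$. $\partial F(x)=\nabla f(x)+\partial r(x)$, with $\partial r$ the convex subdifferential. A point $x$ is $\varepsilon$-stationary if there is $u\in\partial F(x)$ with $\|u\|_2\le\varepsilon$. "Proximable" means that the proximal operator $\mathrm{prox}_{\alpha r}(x)=\mathrm{argmin}_y\frac12\|x-y\|_2^2+\alpha r(y)$ can be computed exactly. Oracle: $f$ is accessible only through noisy evaluations $E_f(x)=f(x)+\xi$, where $\xi$ changes at each call and may be adversarial (not zero-mean). A query is one call to the oracle. ZORO (inputs: initial point $x_0$, sparsity level $s$, step size $\alpha$, query radius $\delta$): set $m=b_1 s\log(d/s)$; draw i.i.d. Rademacher vectors $z_1,\dots,z_m\in\{\pm1\}^d$ once, and let $Z\in\mathbb{R}^{m\times d}$ have rows $\frac1{\sqrt m}z_i^\top$. At iteration $k$: form $y\in\mathbb{R}^m$ with $y_i=\frac{1}{\sqrt m}\,\frac{E_f(x_k+\delta z_i)-E_f(x_k)}{\delta}$; compute $\hat g_k$ as the output of $n$ iterations of CoSaMP on $\min_{\|g\|_0\le s}\|Zg-y\|_2$; set $x_{k+1}=\mathrm{prox}_{\alpha r}(x_k-\alpha\hat g_k)$. The query radius is $\delta=2\sqrt{\sigma/H}$ and $n$ is taken sufficiently large (so that $\rho^n\|\nabla f(x_k)\|_2\le\tau\sqrt{\sigma H}$ for all $k$,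 with $\rho,\tau$ below). CoSaMP: start from $g^0=0$; given $g^j$, let $U=\mathrm{supp}(g^j)\cup\mathrm{supp}([Z^\top(y-Zg^j)]_{(2s)})$, let $u$ minimize $\|y-Zv\|_2$ over $v$ supported in $U$, and set $g^{j+1}=[u]_{(s)}$. Constants: $Z$ has the $4s$-RIP with constant $\delta_{4s}(Z)\in(0,1)$ if $(1-\delta_{4s}(Z))\|v\|_2^2\le\|Zv\|_2^2\le(1+\delta_{4s}(Z))\|v\|_2^2$ for all $v$ with $\|v\|_0\le 4s$. $b_1,b_2$ are constants (independent of $s,d,m$) for which, by a known theorem, the random matrix $Z\in\mathbb{R}^{m\times d}$ with rows $\frac1{\sqrt m}z_i^\top$, where $m=b_1s\log(d/s)$ and $z_1,\dots,z_m\in\{\pm1\}^d$ are i.i.d. Rademacher vectors, has the $4s$-RIP with $\delta_{4s}(Z)\le0.3843$ with probability (at least) $1-2(s/d)^{b_2s}$. $\rho<1$ and $\tau\approx10$ are the constants, depending only on $\delta_{4s}$, in the known CoSaMP guarantee: on the event that $Z$ has the $4s$-RIP with $\delta_{4s}(Z)\le0.3843$, for all $g\in\mathbb{R}^d$ and $y=Zg+e$, $\|g^n-g\|_2\le\|g-[g]_{(s)}\|_2+\tau\|Z(g-[g]_{(s)})\|_2+\tau\|e\|_2+\rho^n\|[g]_{(s)}\|_2$. $b_5$ is a constant arising from the use of compressed sensing to reconstruct the gradient; it depends only on the compressed sensing algorithm used (CoSaMP) and the number of iterations it is run for, not on $F$ or $\varepsilon$.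
   Formalization: When the query bound is positive but smaller than the cost m+1 of one ZORO iteration, the first iteration may still be completed; literally the bound fails there (f=0, r the l1 norm, x_0 tiny and nonzero, ε<1). *)

theory Defs
  imports "HOL-Probability.Probability"
begin

section \<open>Sparsity and the restricted isometry property\<close>

definition supp :: "real ^ 'n \<Rightarrow> 'n set" where
  "supp v = {i. v $ i \<noteq> 0}"

definition nnz :: "real ^ 'n \<Rightarrow> nat" where
  "nnz v = card (supp v)"

definition l1_matrix :: "real ^ 'n ^ 'm \<Rightarrow> real" where
  "l1_matrix A = (\<Sum>i\<in>UNIV. \<Sum>j\<in>UNIV. \<bar>A $ i $ j\<bar>)"

text \<open>
  Best \<open>s\<close>-sparse approximations need not be unique, so \<open>[v]\<^sub>(\<^sub>s\<^sub>)\<close> is a relation: everything below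
  is stated for every way of breaking ties.
\<close>

definition best_sparse :: "nat \<Rightarrow> real ^ 'n \<Rightarrow> real ^ 'n \<Rightarrow> bool" where
  "best_sparse s v w \<longleftrightarrow> is_arg_min (\<lambda>w. norm (v - w)) (\<lambda>w. nnz w \<le> s) w"

definition rip :: "nat \<Rightarrow> real \<Rightarrow> real ^ 'n ^ 'm \<Rightarrow> bool" where
  "rip k \<delta> Z \<longleftrightarrow> 0 < \<delta> \<and> \<delta> < 1 \<and>
     (\<forall>v. nnz v \<le> k \<longrightarrow>
        (1 - \<delta>) * (norm v)\<^sup>2 \<le> (norm (Z *v v))\<^sup>2 \<and> (norm (Z *v v))\<^sup>2 \<le> (1 + \<delta>) * (norm v)\<^sup>2)"

section \<open>CoSaMP\<close>

definition cosamp_step ::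
  "nat \<Rightarrow> real ^ 'n ^ 'm \<Rightarrow> real ^ 'm \<Rightarrow> real ^ 'n \<Rightarrow> real ^ 'n \<Rightarrow> bool" where
  "cosamp_step s Z y g g' \<longleftrightarrow>
     (\<exists>w u. best_sparse (2 * s) (transpose Z *v (y - Z *v g)) w \<and>
            is_arg_min (\<lambda>v. norm (y - Z *v v)) (\<lambda>v. supp v \<subseteq> supp g \<union> supp w) u \<and>
            best_sparse s u g')"

definition cosamp_output ::
  "nat \<Rightarrow> real ^ 'n ^ 'm \<Rightarrow> real ^ 'm \<Rightarrow> nat \<Rightarrow> real ^ 'n \<Rightarrow> bool" where
  "cosamp_output s Z y n ghat \<longleftrightarrow> (cosamp_step s Z y ^^ n) 0 ghat"

definition cosamp_guarantee :: "nat \<Rightarrow> real \<Rightarrow> real \<Rightarrow> real ^ 'n ^ 'm \<Rightarrow> bool" where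
  "cosamp_guarantee s \<rho> \<tau> Z \<longleftrightarrow>
     (\<forall>g gs e n gn. best_sparse s g gs \<and> cosamp_output s Z (Z *v g + e) n gn \<longrightarrow>
        norm (gn - g) \<le> norm (g - gs) + \<tau> * norm (Z *v (g - gs)) + \<tau> * norm e + \<rho> ^ n * norm gs)"

section \<open>Extended-valued convex functions and stationarity\<close>

definition convex_ext :: "('a::real_vector \<Rightarrow> ereal) \<Rightarrow> bool" where
  "convex_ext r \<longleftrightarrow>
     (\<forall>x y t. 0 \<le> t \<and> t \<le> 1 \<longrightarrow>
        r (t *\<^sub>R x + (1 - t) *\<^sub>R y) \<le> ereal t * r x + ereal (1 - t) * r y)"

text \<open>
  For a function that is not identically \<open>\<infinity>\<close> this set is empty at the points where the function
  is \<open>\<infinity>\<close>.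
\<close>

definition subdiff :: "('a::real_inner \<Rightarrow> ereal) \<Rightarrow> 'a \<Rightarrow> 'a set" where
  "subdiff r x = {u. \<forall>y. r x + ereal (u \<bullet> (y - x)) \<le> r y}"

definition eps_stationary ::
  "('a::real_inner \<Rightarrow> 'a) \<Rightarrow> ('a \<Rightarrow> ereal) \<Rightarrow> real \<Rightarrow> 'a \<Rightarrow> bool" where
  "eps_stationary grad r \<epsilon> x \<longleftrightarrow> (\<exists>u \<in> {grad x + v |v. v \<in> subdiff r x}. norm u \<le> \<epsilon>)"

definition prox_objective :: "real \<Rightarrow> ('a::real_normed_vector \<Rightarrow> ereal) \<Rightarrow> 'a \<Rightarrow> 'a \<Rightarrow> ereal" where
  "prox_objective \<alpha> r x y = ereal (1 / 2 * (norm (x - y))\<^sup>2) + ereal \<alpha> * r y"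

definition prox :: "real \<Rightarrow> ('a::real_normed_vector \<Rightarrow> ereal) \<Rightarrow> 'a \<Rightarrow> 'a" where
  "prox \<alpha> r x = arg_min (prox_objective \<alpha> r x) (\<lambda>_. True)"

text \<open>
  \<open>arg_min\<close> is arbitrary when there is no minimizer. As \<open>r\<close> is not assumed to be lower
  semicontinuous, the existence of the minimizers is the content of being proximable.
\<close>

definition proximable :: "('a::real_normed_vector \<Rightarrow> ereal) \<Rightarrow> bool" where
  "proximable r \<longleftrightarrow> (\<forall>\<alpha> x. 0 < \<alpha> \<longrightarrow> (\<exists>y. is_arg_min (prox_objective \<alpha> r x) (\<lambda>_. True) y))"

section \<open>ZORO\<close>

definition iid_rademacher :: "'w measure \<Rightarrow> ('m::finite \<Rightarrow> 'w \<Rightarrow> real ^ 'n) \<Rightarrow> bool" where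
  "iid_rademacher M z \<longleftrightarrow>
     prob_space.indep_vars M (\<lambda>_. borel) (\<lambda>(i, j) \<omega>. z i \<omega> $ j) UNIV \<and>
     (\<forall>i j. measure M {\<omega> \<in> space M. z i \<omega> $ j = 1} = 1 / 2 \<and>
            measure M {\<omega> \<in> space M. z i \<omega> $ j = - 1} = 1 / 2)"

definition sensing_matrix :: "('m::finite \<Rightarrow> real ^ 'n) \<Rightarrow> real ^ 'n ^ 'm" where
  "sensing_matrix z = (\<chi> i. (1 / sqrt (real CARD('m))) *\<^sub>R z i)"

text \<open>
  One iteration, from \<open>x\<close> to \<open>x'\<close>. It makes \<open>CARD('m) + 1\<close> queries: one at \<open>x\<close>, with noise
  \<open>\<xi>0\<close>, and one at each \<open>x + \<delta> z\<^sub>i\<close>, with noise \<open>\<xi> i\<close>. The noise is adversarial, so every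
  choice bounded by \<open>\<sigma>\<close> yields a possible step, and the noise may depend on the directions
  \<open>z\<close> and on all previous iterates.
\<close>

definition zoro_step ::
  "(real ^ 'n \<Rightarrow> real) \<Rightarrow> (real ^ 'n \<Rightarrow> ereal) \<Rightarrow> real \<Rightarrow> nat \<Rightarrow> real \<Rightarrow> real \<Rightarrow> nat \<Rightarrow>
   ('m::finite \<Rightarrow> real ^ 'n) \<Rightarrow> real ^ 'n \<Rightarrow> real ^ 'n \<Rightarrow> bool" where
  "zoro_step f r \<sigma> s \<alpha> \<delta> n z x x' \<longleftrightarrow>
     (\<exists>\<xi>0 \<xi> y ghat.
        \<bar>\<xi>0\<bar> \<le> \<sigma> \<and> (\<forall>i. \<bar>\<xi> i\<bar> \<le> \<sigma>) \<and>
        y = (\<chi> i. 1 / sqrt (real CARD('m)) *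
                 (((f (x + \<delta> *\<^sub>R z i) + \<xi> i) - (f x + \<xi>0)) / \<delta>)) \<and>
        cosamp_output s (sensing_matrix z) y n ghat \<and>
        x' = prox \<alpha> r (x - \<alpha> *\<^sub>R ghat))"

definition zoro_run ::
  "(real ^ 'n \<Rightarrow> real) \<Rightarrow> (real ^ 'n \<Rightarrow> ereal) \<Rightarrow> real \<Rightarrow> real ^ 'n \<Rightarrow> nat \<Rightarrow> real \<Rightarrow> real \<Rightarrow> nat \<Rightarrow>
   ('m::finite \<Rightarrow> real ^ 'n) \<Rightarrow> (nat \<Rightarrow> real ^ 'n) \<Rightarrow> bool" where
  "zoro_run f r \<sigma> x0 s \<alpha> \<delta> n z x \<longleftrightarrow>
     x 0 = x0 \<and> (\<forall>k. zoro_step f r \<sigma> s \<alpha> \<delta> n z (x k) (x (Suc k)))"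

text \<open>
  The source leaves this constant unspecified, up to its depending only on CoSaMP; an explicit
  value makes it independent of everything but \<open>\<tau>\<close>, the dimension included. With \<open>\<delta> = 2 sqrt (\<sigma> / H)\<close> the measurement error is
  at most \<open>2 sqrt (\<sigma> H)\<close>, so the CoSaMP guarantee bounds the gradient error by
  \<open>\<eta> = 3 \<tau> sqrt (\<sigma> H)\<close>; an inexact proximal gradient step then loses at most \<open>5 \<eta>\<close>.
\<close>

definition b5 :: "real \<Rightarrow> real" where
  "b5 \<tau> = 15 * \<tau>"

end

theory Submission
  imports Defs
begin

text \<open>
  Randomness enters only through the event that the entries of the directions \<open>z\<close> have modulus at
  most 1 and the sensing matrix has the restricted isometry property. For every outcome in it the
  argument is deterministic and covers every choice of the adversarial noise.

  The gradient is \<open>s\<close>-sparse, so CoSaMP has no approximation term and the error of its output is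
  governed by the measurement error. Each finite difference is off by at most
  \<open>2 \<sigma> / \<delta>\<close> from the noise and \<open>\<delta> H / 2\<close> from the curvature, because
  \<open>z \<bullet> \<nabla>\<^sup>2 f z\<close> is bounded by the entrywise norm of the Hessian for such
  directions. The radius \<open>\<delta> = 2 sqrt (\<sigma> / H)\<close> balances the two at \<open>sqrt (\<sigma> H)\<close> each, and the
  gradient estimate is within \<open>\<eta> = 3 \<tau> sqrt (\<sigma> H)\<close> of the gradient
  (\<open>zoro_step_inexact_prox\<close>). Note that \<open>5 \<eta> = b5 \<tau> * sqrt (\<sigma> H)\<close>.

  A proximal gradient step of length \<open>1 / L\<close> with such an estimate either lands on an
  \<open>\<epsilon>\<close>-stationary point or decreases \<open>F\<close> by at least \<open>c = 3 (\<epsilon> - 5 \<eta>)\<^sup>2 / (8 L)\<close>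
  (\<open>inexact_prox_gradient_descent\<close>). Since \<open>F\<close> is bounded below by \<open>F\<^sup>\<star>\<close>, the first stationary
  iterate \<open>x\<^sub>k\<close> with \<open>k \<ge> 1\<close> satisfies \<open>(k - 1) c \<le> e\<^sub>0\<close>.

  It remains to turn this into a count of queries, \<open>m + 1\<close> per iteration, with
  \<open>m \<le> b1 s ln d\<close>. For \<open>k \<ge> 2\<close> the crude bounds \<open>k \<le> 2 (k - 1)\<close> and \<open>m + 1 \<le> 2 m\<close> give
  \<open>k (m + 1) \<le> 4 m e\<^sub>0 / c = (32 / 3) L m e\<^sub>0 / (\<epsilon> - 5 \<eta>)\<^sup>2\<close>, and \<open>32 / 3 \<le> 12\<close>. The numerical
  constant leaves little room: the textbook descent lemma only gives a decrease of
  \<open>(\<epsilon> - 5 \<eta>)\<^sup>2 / (8 L)\<close>, for which this rounding is too expensive. The missing factor 3 comes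
  from \<open>smooth_upper_bound_with_gradient_gap\<close>, which retains the gap between the two gradients in
  the quadratic upper bound.

  Two boundary cases are separate. If \<open>e\<^sub>0 = 0\<close>, the budget is zero and \<open>x\<^sub>0\<close> itself, being a
  minimizer, is stationary. If \<open>F x\<^sub>0 = \<infinity>\<close>, the budget is infinite, and the descent argument
  starts at \<open>x\<^sub>1\<close>, where \<open>F\<close> is finite.
\<close>

section \<open>Smooth functions\<close>

text \<open>
  A common source for the two first-order estimates below: a bound growing linearly along the
  segment on the change of the directional derivative integrates to half its final value. The
  integration is replaced by monotonicity: the error along the segment minus \<open>B t\<^sup>2 / 2\<close> decreases,
  and plus \<open>B t\<^sup>2 / 2\<close> it increases.
\<close>

lemma first_order_error_bound:
  fixes f :: "'a::real_inner \<Rightarrow> real"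
  assumes f: "\<And>x. GDERIV f x :> grad x"
    and B: "\<And>t. 0 \<le> t \<Longrightarrow> t \<le> 1 \<Longrightarrow> \<bar>(grad (x + t *\<^sub>R h) - grad x) \<bullet> h\<bar> \<le> B * t"
  shows "\<bar>f (x + h) - f x - grad x \<bullet> h\<bar> \<le> B / 2"
proof -
  have f': "((\<lambda>t. f (x + t *\<^sub>R h)) has_real_derivative grad (x + t *\<^sub>R h) \<bullet> h) (at t)" for t
  proof -
    have "((\<lambda>t. f (x + t *\<^sub>R h)) has_derivative (\<lambda>k. (k *\<^sub>R h) \<bullet> grad (x + t *\<^sub>R h))) (at t)"
      by (rule has_derivative_compose[OF _ f[unfolded gderiv_def]])
        (auto intro!: derivative_eq_intros)
    then show ?thesis
      by (simp add: has_field_derivative_def inner_commute mult_commute_abs)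
  qed
  have "f (x + 1 *\<^sub>R h) - f x - 1 * (grad x \<bullet> h) - B * 1\<^sup>2 / 2
      \<le> f (x + 0 *\<^sub>R h) - f x - 0 * (grad x \<bullet> h) - B * 0\<^sup>2 / 2"
  proof (rule DERIV_nonpos_imp_nonincreasing
      [where f = "\<lambda>t. f (x + t *\<^sub>R h) - f x - t * (grad x \<bullet> h) - B * t\<^sup>2 / 2"])
    fix t :: real assume t: "0 \<le> t" "t \<le> 1"
    have "((\<lambda>t. f (x + t *\<^sub>R h) - f x - t * (grad x \<bullet> h) - B * t\<^sup>2 / 2) has_real_derivative
        grad (x + t *\<^sub>R h) \<bullet> h - grad x \<bullet> h - B * t) (at t)"
      by (auto intro!: derivative_eq_intros f')
    moreover have "grad (x + t *\<^sub>R h) \<bullet> h - grad x \<bullet> h - B * t \<le> 0"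
      using B[OF t] by (simp add: inner_diff_left)
    ultimately show "\<exists>l. ((\<lambda>t. f (x + t *\<^sub>R h) - f x - t * (grad x \<bullet> h) - B * t\<^sup>2 / 2)
        has_real_derivative l) (at t) \<and> l \<le> 0"
      by blast
  qed simp
  moreover have "f (x + 0 *\<^sub>R h) - f x - 0 * (grad x \<bullet> h) + B * 0\<^sup>2 / 2
      \<le> f (x + 1 *\<^sub>R h) - f x - 1 * (grad x \<bullet> h) + B * 1\<^sup>2 / 2"
  proof (rule DERIV_nonneg_imp_nondecreasing
      [where f = "\<lambda>t. f (x + t *\<^sub>R h) - f x - t * (grad x \<bullet> h) + B * t\<^sup>2 / 2"])
    fix t :: real assume t: "0 \<le> t" "t \<le> 1"
    have "((\<lambda>t. f (x + t *\<^sub>R h) - f x - t * (grad x \<bullet> h) + B * t\<^sup>2 / 2) has_real_derivative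
        grad (x + t *\<^sub>R h) \<bullet> h - grad x \<bullet> h + B * t) (at t)"
      by (auto intro!: derivative_eq_intros f')
    moreover have "grad (x + t *\<^sub>R h) \<bullet> h - grad x \<bullet> h + B * t \<ge> 0"
      using B[OF t] by (simp add: inner_diff_left)
    ultimately show "\<exists>l. ((\<lambda>t. f (x + t *\<^sub>R h) - f x - t * (grad x \<bullet> h) + B * t\<^sup>2 / 2)
        has_real_derivative l) (at t) \<and> 0 \<le> l"
      by blast
  qed simp
  ultimately show ?thesis by (intro abs_leI) simp_all
qed

lemma smooth_quadratic_bound:
  fixes f :: "'a::real_inner \<Rightarrow> real"
  assumes f: "\<And>x. GDERIV f x :> grad x"
    and lip: "\<And>x y. norm (grad x - grad y) \<le> L * norm (x - y)"
  shows "\<bar>f y - f x - grad x \<bullet> (y - x)\<bar> \<le> L / 2 * (norm (y - x))\<^sup>2"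
proof -
  have "\<bar>(grad (x + t *\<^sub>R (y - x)) - grad x) \<bullet> (y - x)\<bar> \<le> L * (norm (y - x))\<^sup>2 * t"
    if "0 \<le> t" for t
  proof -
    have "\<bar>(grad (x + t *\<^sub>R (y - x)) - grad x) \<bullet> (y - x)\<bar>
        \<le> norm (grad (x + t *\<^sub>R (y - x)) - grad x) * norm (y - x)"
      by (rule Cauchy_Schwarz_ineq2)
    also have "\<dots> \<le> L * norm (t *\<^sub>R (y - x)) * norm (y - x)"
      using lip[of "x + t *\<^sub>R (y - x)" x] by (intro mult_right_mono) auto
    finally show ?thesis using that by (simp add: power2_eq_square mult_ac)
  qed
  from first_order_error_bound[of f grad x "y - x", OF f this] show ?thesis by simp
qed

text \<open>
  The descent lemma with a gradient gap. The function \<open>L / 2 * (norm x)\<^sup>2 - f x\<close> is convex with a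
  \<open>2 L\<close>-Lipschitz gradient, and the statement is the cocoercivity inequality for it: a convex
  smooth function exceeds its tangents by a multiple of the squared difference of the gradients.
  As usual this is obtained by comparing, at an auxiliary point, the quadratic upper bound from
  \<open>x\<close> with the quadratic lower bound from \<open>y\<close>.
\<close>

lemma smooth_upper_bound_with_gradient_gap:
  fixes f :: "'a::real_inner \<Rightarrow> real"
  assumes f: "\<And>x. GDERIV f x :> grad x"
    and lip: "\<And>x y. norm (grad x - grad y) \<le> L * norm (x - y)"
    and L: "0 < L"
  shows "f y \<le> f x + grad x \<bullet> (y - x) + L / 2 * (norm (y - x))\<^sup>2
      - (norm (L *\<^sub>R (x - y) - (grad x - grad y)))\<^sup>2 / (4 * L)"
proof -
  define d where "d = y - x"
  define a where "a = grad x - grad y"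
  \<comment> \<open>The auxiliary point is \<open>x + w\<close>; this \<open>w\<close> minimizes the upper bound minus the lower bound.\<close>
  define w where "w = (1 / 2) *\<^sub>R d - (1 / (2 * L)) *\<^sub>R a"
  have "f (x + w) \<le> f x + grad x \<bullet> w + L / 2 * (norm w)\<^sup>2"
    using abs_le_D1[OF smooth_quadratic_bound[OF f lip, of "x + w" x]] by simp
  moreover have "f y + grad y \<bullet> (w - d) - L / 2 * (norm (w - d))\<^sup>2 \<le> f (x + w)"
    using abs_le_D2[OF smooth_quadratic_bound[OF f lip, of "x + w" y]]
    by (simp add: d_def diff_diff_eq2 add.commute)
  ultimately have "f y \<le> f x + grad x \<bullet> w - grad y \<bullet> (w - d)
      + L / 2 * ((norm w)\<^sup>2 + (norm (w - d))\<^sup>2)"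
    by (simp add: algebra_simps)
  also have "grad y = grad x - a" by (simp add: a_def)
  also have "f x + grad x \<bullet> w - (grad x - a) \<bullet> (w - d) + L / 2 * ((norm w)\<^sup>2 + (norm (w - d))\<^sup>2)
      = f x + grad x \<bullet> d + L / 2 * (norm d)\<^sup>2 - (norm (- L *\<^sub>R d - a))\<^sup>2 / (4 * L)"
    unfolding w_def power2_norm_eq_inner
    using L by (simp add: inner_simps inner_commute field_simps)
  finally show ?thesis by (simp add: d_def a_def scaleR_right_diff_distrib)
qed

section \<open>Proximal steps\<close>

text \<open>
  Fermat's rule for a smooth plus a convex function. Along the segment from the minimizer \<open>x\<close> to
  \<open>y\<close>, convexity replaces \<open>r\<close> by its chord, which leaves a differentiable function of one
  variable minimal at the left end; its derivative there is nonnegative, which is the subgradient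
  inequality at \<open>y\<close>. The lemma serves both for the proximal map, where \<open>h\<close> is the quadratic
  term, and for a minimizer of \<open>F\<close>.
\<close>

lemma minimizer_imp_subgradient:
  fixes h :: "'a::real_inner \<Rightarrow> real"
  assumes h: "GDERIV h x :> D" and r: "convex_ext r" "\<And>y. r y \<noteq> - \<infinity>" "r x \<noteq> \<infinity>" and a: "0 < a"
    and min: "\<And>y. ereal (h x) + ereal a * r x \<le> ereal (h y) + ereal a * r y"
  shows "- (1 / a) *\<^sub>R D \<in> subdiff r x"
  unfolding subdiff_def
proof (intro CollectI allI)
  fix y
  show "r x + ereal (- (1 / a) *\<^sub>R D \<bullet> (y - x)) \<le> r y"
  proof (cases "r y")
    case (real ry)
    obtain rx where rx: "r x = ereal rx" using r(2)[of x] r(3) by (cases "r x") auto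
    have mono: "h x \<le> h (x + t *\<^sub>R (y - x)) + t * (a * (ry - rx))" if t: "0 < t" "t \<le> 1" for t
    proof -
      have "r (x + t *\<^sub>R (y - x)) \<le> ereal (t * ry + (1 - t) * rx)"
        using r(1)[unfolded convex_ext_def, rule_format, of t y x] t
        by (simp add: real rx algebra_simps)
      moreover have "ereal (h x + a * rx) \<le> ereal (h (x + t *\<^sub>R (y - x))) + ereal a * r (x + t *\<^sub>R (y - x))"
        using min[of "x + t *\<^sub>R (y - x)"] rx by simp
      moreover obtain rt where rt: "r (x + t *\<^sub>R (y - x)) = ereal rt"
        using calculation(1) r(2)[of "x + t *\<^sub>R (y - x)"] by (cases "r (x + t *\<^sub>R (y - x))") auto
      ultimately have "h x + a * rx \<le> h (x + t *\<^sub>R (y - x)) + a * rt" "rt \<le> t * ry + (1 - t) * rx"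
        by simp_all
      moreover from this(2) have "a * rt \<le> a * (t * ry + (1 - t) * rx)"
        using a by (intro mult_left_mono) auto
      ultimately show ?thesis by (simp add: algebra_simps)
    qed
    define \<psi> where "\<psi> t = h (x + t *\<^sub>R (y - x)) + t * (a * (ry - rx))" for t
    have "((\<lambda>t. h (x + t *\<^sub>R (y - x))) has_derivative (\<lambda>k. (k *\<^sub>R (y - x)) \<bullet> D)) (at 0)"
      by (rule has_derivative_compose[where g = h])
        (use h in \<open>auto intro!: derivative_eq_intros simp: gderiv_def\<close>)
    then have "((\<lambda>t. h (x + t *\<^sub>R (y - x))) has_real_derivative (y - x) \<bullet> D) (at 0)"
      by (simp add: has_field_derivative_def mult_commute_abs)
    then have \<psi>': "(\<psi> has_real_derivative (y - x) \<bullet> D + a * (ry - rx)) (at 0)"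
      unfolding \<psi>_def by (auto intro!: derivative_eq_intros)
    have "\<not> (y - x) \<bullet> D + a * (ry - rx) < 0"
    proof
      assume "(y - x) \<bullet> D + a * (ry - rx) < 0"
      from has_real_derivative_neg_dec_right[OF \<psi>' this]
      obtain e where e: "e > 0" "\<And>t. 0 < t \<Longrightarrow> t < e \<Longrightarrow> \<psi> t < \<psi> 0" by auto
      define t where "t = min 1 (e / 2)"
      have t: "0 < t" "t \<le> 1" "t < e" using e(1) by (auto simp: t_def)
      show False
        using e(2)[OF t(1,3)] mono[OF t(1,2)] by (simp add: \<psi>_def)
    qed
    then have "- (1 / a) * (D \<bullet> (y - x)) \<le> ry - rx"
      using a by (simp add: inner_commute field_simps)
    then show ?thesis by (simp add: real rx)
  qed (use r(2) in auto)
qed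

lemma prox_is_arg_min:
  assumes "proximable r" "0 < \<alpha>"
  shows "prox_objective \<alpha> r x (prox \<alpha> r x) \<le> prox_objective \<alpha> r x y"
proof -
  have "is_arg_min (prox_objective \<alpha> r x) (\<lambda>_. True) (prox \<alpha> r x)"
    unfolding prox_def arg_min_def
    by (rule someI_ex) (use assms in \<open>simp add: proximable_def\<close>)
  then show ?thesis by (simp add: is_arg_min_linorder)
qed

lemma prox_finite:
  assumes "proximable r" "0 < \<alpha>" "r y \<noteq> \<infinity>" "\<And>y. r y \<noteq> - \<infinity>"
  shows "r (prox \<alpha> r x) \<noteq> \<infinity>"
  using prox_is_arg_min[OF assms(1,2), of x y] assms
  by (cases "r y") (auto simp: prox_objective_def)

lemma prox_subgradient:
  fixes r :: "'a::real_inner \<Rightarrow> ereal"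
  assumes r: "proximable r" "convex_ext r" "\<And>y. r y \<noteq> - \<infinity>" "r y \<noteq> \<infinity>" and \<alpha>: "0 < \<alpha>"
  shows "(1 / \<alpha>) *\<^sub>R (x - prox \<alpha> r x) \<in> subdiff r (prox \<alpha> r x)"
proof -
  let ?p = "prox \<alpha> r x"
  have "((\<lambda>y. 1 / 2 * ((x - y) \<bullet> (x - y))) has_derivative (\<lambda>k. k \<bullet> (?p - x))) (at ?p)"
    by (auto intro!: derivative_eq_intros simp: inner_simps inner_commute fun_eq_iff field_simps)
  then have "GDERIV (\<lambda>y. 1 / 2 * (norm (x - y))\<^sup>2) ?p :> ?p - x"
    by (simp add: gderiv_def power2_norm_eq_inner)
  from minimizer_imp_subgradient[OF this r(2,3) prox_finite[OF r(1) \<alpha> r(4,3)] \<alpha>]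
    prox_is_arg_min[OF r(1) \<alpha>, of x]
  show ?thesis
    by (simp add: prox_objective_def flip: scaleR_minus_right)
qed

text \<open>
  The progress of one step. With \<open>d = x - x'\<close>, \<open>e = g - grad x\<close> and
  \<open>w = L d - (grad x - grad x')\<close>, the step exhibits \<open>w - e\<close> as a subgradient of \<open>F\<close> at \<open>x'\<close>, so
  failure of stationarity makes \<open>w\<close> longer than \<open>\<epsilon> - \<eta>\<close>; and as \<open>norm w \<le> 2 L * norm d\<close>, the
  step is long as well. The same \<open>w\<close> is the gradient gap in the refined descent lemma. Together
  with the subgradient inequality for \<open>r\<close> the decrease is at least
  \<open>L / 2 * (norm d)\<^sup>2 - \<eta> * norm d + (norm w)\<^sup>2 / (4 * L)\<close>, of which the first two terms
  contribute one third of the claim and the last one two thirds.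

  The conclusion is stated in the extended reals so that it also covers a start \<open>x\<close> outside the
  domain of \<open>r\<close>.
\<close>

lemma inexact_prox_gradient_descent:
  fixes f :: "'a::real_inner \<Rightarrow> real"
  assumes f: "\<And>x. GDERIV f x :> grad x"
    and lip: "\<And>x y. norm (grad x - grad y) \<le> L * norm (x - y)"
    and L: "0 < L"
    and sub: "L *\<^sub>R (x - x') - g \<in> subdiff r x'"
    and g: "norm (g - grad x) \<le> \<eta>"
    and eps: "5 * \<eta> < \<epsilon>"
    and nonstat: "\<not> eps_stationary grad r \<epsilon> x'"
  shows "ereal (f x') + r x' + ereal (3 * (\<epsilon> - 5 * \<eta>)\<^sup>2 / (8 * L)) \<le> ereal (f x) + r x"
proof -
  define d where "d = x - x'"
  define e where "e = g - grad x"
  define v where "v = L *\<^sub>R d - g"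
  define w where "w = L *\<^sub>R d - (grad x - grad x')"
  define q where "q = L * norm d"
  have \<eta>: "0 \<le> \<eta>" using g norm_ge_zero order_trans by blast
  have v: "v \<in> subdiff r x'" using sub by (simp add: v_def d_def)
  have "\<epsilon> < norm (grad x' + v)"
    using nonstat v by (auto simp: eps_stationary_def not_le)
  also have "grad x' + v = w - e" by (simp add: v_def w_def e_def)
  also have "norm (w - e) \<le> norm w + \<eta>"
    using norm_triangle_ineq4[of w e] g by (simp add: e_def)
  finally have w: "\<epsilon> - \<eta> < norm w" by simp
  have "norm w \<le> norm (L *\<^sub>R d) + norm (grad x - grad x')"
    unfolding w_def by (rule norm_triangle_ineq4)
  also have "\<dots> \<le> 2 * q" using lip[of x x'] L by (simp add: q_def d_def)
  finally have q: "norm w / 2 \<le> q" by simp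
  \<comment> \<open>The decrease multiplied by \<open>8 * L\<close>; \<open>q - 2 * \<eta>\<close> is positive because \<open>\<epsilon> - \<eta> > 4 * \<eta>\<close>.\<close>
  have "3 * (\<epsilon> - 5 * \<eta>)\<^sup>2 \<le> 4 * q * (q - 2 * \<eta>) + 2 * (norm w)\<^sup>2"
  proof -
    define a p where "a = \<epsilon> - \<eta>" and "p = \<epsilon> - 5 * \<eta>"
    have ap: "0 < p" "p \<le> a" "a - 4 * \<eta> = p" using eps \<eta> by (auto simp: a_def p_def)
    have "p\<^sup>2 \<le> a * p" using ap by (simp add: power2_eq_square mult_right_mono)
    also have "\<dots> = 4 * (a / 2) * (a / 2 - 2 * \<eta>)" using ap(3) by (simp add: field_simps)
    also have "\<dots> \<le> 4 * q * (q - 2 * \<eta>)"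
      using q w ap by (intro mult_mono) (auto simp: a_def)
    finally have "p\<^sup>2 \<le> 4 * q * (q - 2 * \<eta>)" .
    moreover have "p\<^sup>2 \<le> (norm w)\<^sup>2" using ap w by (intro power_mono) (auto simp: a_def)
    ultimately show ?thesis by (simp add: p_def)
  qed
  then have "3 * (\<epsilon> - 5 * \<eta>)\<^sup>2 / (8 * L) \<le> (4 * q * (q - 2 * \<eta>) + 2 * (norm w)\<^sup>2) / (8 * L)"
    using L by (intro divide_right_mono) auto
  also have "\<dots> = L / 2 * (norm d)\<^sup>2 - \<eta> * norm d + (norm w)\<^sup>2 / (4 * L)"
    using L by (simp add: q_def field_simps power2_eq_square)
  also have "\<dots> \<le> L / 2 * (norm d)\<^sup>2 - e \<bullet> d + (norm w)\<^sup>2 / (4 * L)"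
  proof -
    have "e \<bullet> d \<le> norm e * norm d" by (rule norm_cauchy_schwarz)
    also have "\<dots> \<le> \<eta> * norm d" using g by (intro mult_right_mono) (auto simp: e_def)
    finally show ?thesis by simp
  qed
  also have "\<dots> \<le> f x + v \<bullet> d - f x'"
  proof -
    have "grad x \<bullet> (x' - x) = - (grad x \<bullet> d)" "norm (x' - x) = norm d"
      by (simp_all add: d_def inner_diff_right norm_minus_commute)
    moreover have "v \<bullet> d = L * (norm d)\<^sup>2 - e \<bullet> d - grad x \<bullet> d"
      by (simp add: v_def e_def inner_simps power2_norm_eq_inner)
    ultimately show ?thesis
      using smooth_upper_bound_with_gradient_gap[OF f lip L, of x' x]
      by (simp add: w_def d_def algebra_simps)
  qed
  finally have "f x' + 3 * (\<epsilon> - 5 * \<eta>)\<^sup>2 / (8 * L) \<le> f x + v \<bullet> d" by simp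
  then have "ereal (f x') + r x' + ereal (3 * (\<epsilon> - 5 * \<eta>)\<^sup>2 / (8 * L))
      \<le> ereal (f x) + (r x' + ereal (v \<bullet> d))"
    by (cases "r x'") auto
  also have "\<dots> \<le> ereal (f x) + r x"
    using v by (intro add_left_mono) (auto simp: subdiff_def d_def)
  finally show ?thesis .
qed

lemma exists_good_index_of_descent:
  fixes a :: "nat \<Rightarrow> real"
  assumes c: "0 < c" and lb: "\<And>k. b \<le> a k"
    and desc: "\<And>k. \<not> P (Suc k) \<Longrightarrow> a (Suc k) + c \<le> a k"
  shows "\<exists>k. P (Suc k) \<and> real k * c \<le> a 0 - b"
proof -
  have sum: "a k + real k * c \<le> a 0" if "\<forall>j<k. \<not> P (Suc j)" for k
    using that
  proof (induction k)
    case (Suc k)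
    then show ?case using desc[of k] by (simp add: algebra_simps)
  qed simp
  have ex: "\<exists>k. P (Suc k)"
  proof (rule ccontr)
    assume no: "\<nexists>k. P (Suc k)"
    obtain k where "a 0 - b < real k * c" using reals_Archimedean3[OF c] by blast
    moreover have "a k + real k * c \<le> a 0" using sum no by blast
    ultimately show False using lb[of k] by linarith
  qed
  define k where "k = (LEAST k. P (Suc k))"
  have "P (Suc k)" using ex unfolding k_def by (rule LeastI_ex)
  moreover have "\<forall>j<k. \<not> P (Suc j)" unfolding k_def using not_less_Least by blast
  ultimately show ?thesis using sum[of k] lb[of k] by (intro exI[of _ k]) auto
qed

section \<open>Gradient estimation\<close>

lemma quadratic_form_le_l1:
  fixes A :: "real ^ 'n ^ 'n"
  assumes "\<And>j. \<bar>z $ j\<bar> \<le> 1"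
  shows "\<bar>(A *v z) \<bullet> z\<bar> \<le> l1_matrix A"
proof -
  have "(A *v z) \<bullet> z = (\<Sum>i\<in>UNIV. \<Sum>j\<in>UNIV. A $ i $ j * (z $ j * z $ i))"
    by (simp add: inner_vec_def matrix_vector_mult_def sum_distrib_left mult_ac)
  also have "\<bar>\<dots>\<bar> \<le> (\<Sum>i\<in>UNIV. \<Sum>j\<in>UNIV. \<bar>A $ i $ j * (z $ j * z $ i)\<bar>)"
    by (intro order_trans[OF sum_abs] sum_mono) simp
  also have "\<dots> \<le> (\<Sum>i\<in>UNIV. \<Sum>j\<in>UNIV. \<bar>A $ i $ j\<bar>)"
    using assms by (intro sum_mono) (simp add: abs_mult mult_left_le mult_le_one)
  finally show ?thesis by (simp add: l1_matrix_def)
qed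

lemma finite_difference_error:
  fixes f :: "real ^ 'n \<Rightarrow> real"
  assumes f: "\<And>x. GDERIV f x :> grad x"
    and hess: "\<And>x. (grad has_derivative (\<lambda>h. hess x *v h)) (at x)"
    and H: "\<And>x. l1_matrix (hess x) \<le> H"
    and z: "\<And>j. \<bar>z $ j\<bar> \<le> 1"
  shows "\<bar>f (x + \<delta> *\<^sub>R z) - f x - \<delta> * (grad x \<bullet> z)\<bar> \<le> \<delta>\<^sup>2 * H / 2"
proof -
  let ?h = "\<delta> *\<^sub>R z"
  have "\<bar>(grad (x + t *\<^sub>R ?h) - grad x) \<bullet> ?h\<bar> \<le> \<delta>\<^sup>2 * H * t" if t: "0 \<le> t" for t
  proof -
    have d: "((\<lambda>t. grad (x + t *\<^sub>R ?h) \<bullet> ?h) has_real_derivative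
        \<delta>\<^sup>2 * ((hess (x + t *\<^sub>R ?h) *v z) \<bullet> z)) (at t)" for t
    proof -
      have "((\<lambda>t. grad (x + t *\<^sub>R ?h)) has_derivative (\<lambda>k. hess (x + t *\<^sub>R ?h) *v (k *\<^sub>R ?h))) (at t)"
        by (rule has_derivative_compose[OF _ hess]) (auto intro!: derivative_eq_intros)
      from has_derivative_inner_left[OF this, of ?h] show ?thesis
        by (simp add: has_field_derivative_def matrix_vector_mult_scaleR power2_eq_square mult_ac
            mult_commute_abs)
    qed
    have "norm ((\<lambda>t. grad (x + t *\<^sub>R ?h) \<bullet> ?h) t - (\<lambda>t. grad (x + t *\<^sub>R ?h) \<bullet> ?h) 0)
        \<le> \<delta>\<^sup>2 * H * norm (t - 0)"
    proof (rule field_differentiable_bound[where S = UNIV])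
      show "norm (\<delta>\<^sup>2 * ((hess (x + t *\<^sub>R ?h) *v z) \<bullet> z)) \<le> \<delta>\<^sup>2 * H" for t
        using quadratic_form_le_l1[of z "hess (x + t *\<^sub>R ?h)", OF z] H[of "x + t *\<^sub>R ?h"]
        by (simp add: abs_mult mult_left_mono)
    qed (use d in auto)
    then show ?thesis using t by (simp add: inner_diff_left right_diff_distrib)
  qed
  from first_order_error_bound[of f grad x ?h, OF f this] show ?thesis by simp
qed

lemma norm_le_of_scaled_components:
  fixes v :: "real ^ 'm"
  assumes "\<And>i. \<bar>v $ i\<bar> \<le> C / sqrt (real CARD('m))"
  shows "norm v \<le> C"
proof -
  have "0 \<le> C / sqrt (real CARD('m))" using assms abs_ge_zero order_trans by blast
  then have C: "0 \<le> C" by (simp add: zero_le_divide_iff)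
  have "norm v \<le> L2_set (\<lambda>i. C / sqrt (real CARD('m))) (UNIV :: 'm set)"
    unfolding norm_vec_def using assms by (intro L2_set_mono) auto
  also have "\<dots> = C" using C by (simp add: L2_set_def power_divide)
  finally show ?thesis .
qed

text \<open>
  In each coordinate, before the normalization by \<open>1 / sqrt m\<close>, noise and curvature contribute
  \<open>2 * \<sigma> / \<delta>\<close> and \<open>\<delta> * H / 2\<close>, both equal to \<open>sqrt (\<sigma> * H)\<close> for this \<open>\<delta>\<close>. The normalization
  makes the Euclidean norm of the error no larger than the largest coordinate error, so the
  number of measurements does not enter.
\<close>

lemma measurement_error:
  fixes f :: "real ^ 'n \<Rightarrow> real" and z :: "'m::finite \<Rightarrow> real ^ 'n"
  assumes f: "\<And>x. GDERIV f x :> grad x"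
    and hess: "\<And>x. (grad has_derivative (\<lambda>h. hess x *v h)) (at x)"
    and H: "\<And>x. l1_matrix (hess x) \<le> H"
    and z: "\<And>i j. \<bar>z i $ j\<bar> \<le> 1"
    and pos: "0 < H" "0 < \<sigma>"
    and \<xi>: "\<bar>\<xi>0\<bar> \<le> \<sigma>" "\<And>i. \<bar>\<xi> i\<bar> \<le> \<sigma>"
    and \<delta>: "\<delta> = 2 * sqrt (\<sigma> / H)"
  shows "norm ((\<chi> i. 1 / sqrt (real CARD('m)) *
      (((f (x + \<delta> *\<^sub>R z i) + \<xi> i) - (f x + \<xi>0)) / \<delta>)) - sensing_matrix z *v grad x)
      \<le> 2 * sqrt (\<sigma> * H)"
proof (rule norm_le_of_scaled_components)
  fix i
  define c where "c = sqrt (\<sigma> * H)"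
  have c: "0 < c" "c * c = \<sigma> * H" using pos by (auto simp: c_def)
  have \<delta>': "\<delta> = 2 * c / H"
    unfolding \<delta> c_def using pos by (simp add: real_sqrt_divide real_sqrt_mult field_simps)
  define D where "D = f (x + \<delta> *\<^sub>R z i) - f x - \<delta> * (grad x \<bullet> z i)"
  have \<delta>0: "0 < \<delta>" using \<delta>' c pos by simp
  have "\<bar>D\<bar> \<le> \<delta>\<^sup>2 * H / 2"
    unfolding D_def by (rule finite_difference_error[OF f hess H z])
  then have "\<bar>D + \<xi> i - \<xi>0\<bar> \<le> \<delta>\<^sup>2 * H / 2 + 2 * \<sigma>"
    using \<xi>(1) \<xi>(2)[of i] by linarith
  also have "\<delta>\<^sup>2 * H / 2 + 2 * \<sigma> = \<delta> * (2 * c)"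
    using c pos by (simp add: \<delta>' field_simps power2_eq_square)
  finally have "\<bar>(D + \<xi> i - \<xi>0) / \<delta>\<bar> \<le> 2 * c"
    using \<delta>0 by (simp add: field_simps)
  moreover have "(sensing_matrix z *v grad x) $ i = 1 / sqrt (real CARD('m)) * (grad x \<bullet> z i)"
    by (simp add: sensing_matrix_def matrix_vector_mult_def inner_vec_def sum_divide_distrib mult_ac)
  moreover have "((f (x + \<delta> *\<^sub>R z i) + \<xi> i) - (f x + \<xi>0)) / \<delta> - grad x \<bullet> z i = (D + \<xi> i - \<xi>0) / \<delta>"
    using \<delta>0 by (simp add: D_def field_simps)
  ultimately have "((\<chi> i. 1 / sqrt (real CARD('m)) *
      (((f (x + \<delta> *\<^sub>R z i) + \<xi> i) - (f x + \<xi>0)) / \<delta>)) - sensing_matrix z *v grad x) $ i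
      = (D + \<xi> i - \<xi>0) / \<delta> / sqrt (real CARD('m))"
    by (simp only: vector_minus_component vec_lambda_beta flip: right_diff_distrib) simp
  moreover have "\<bar>(D + \<xi> i - \<xi>0) / \<delta> / sqrt (real CARD('m))\<bar>
      \<le> 2 * c / sqrt (real CARD('m))"
    using divide_right_mono[OF \<open>\<bar>(D + \<xi> i - \<xi>0) / \<delta>\<bar> \<le> 2 * c\<close>, of "sqrt (real CARD('m))"]
    by (simp add: abs_mult)
  ultimately show "\<bar>((\<chi> i. 1 / sqrt (real CARD('m)) *
      (((f (x + \<delta> *\<^sub>R z i) + \<xi> i) - (f x + \<xi>0)) / \<delta>)) - sensing_matrix z *v grad x) $ i\<bar>
      \<le> 2 * sqrt (\<sigma> * H) / sqrt (real CARD('m))"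
    by (simp only: c_def)
qed

text \<open>
  A sparse vector is its own best sparse approximation, which removes the first two terms of the
  CoSaMP guarantee; every \<open>y\<close> is a measurement of \<open>g\<close> with error \<open>y - Z *v g\<close>.
\<close>

lemma cosamp_error_of_sparse:
  assumes "cosamp_guarantee s \<rho> \<tau> Z" "nnz g \<le> s" "cosamp_output s Z y n gn"
  shows "norm (gn - g) \<le> \<tau> * norm (y - Z *v g) + \<rho> ^ n * norm g"
proof -
  have "best_sparse s g g" using assms(2) by (simp add: best_sparse_def is_arg_min_def)
  then show ?thesis
    using assms(1)[unfolded cosamp_guarantee_def, rule_format, of g g "y - Z *v g" n gn] assms(3)
    by simp
qed

text \<open>
  The factor 3 is two parts of measurement error, amplified by \<open>\<tau>\<close>, and one part for the
  incomplete convergence of CoSaMP after \<open>n\<close> iterations.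
\<close>

lemma zoro_step_inexact_prox:
  fixes f :: "real ^ 'n \<Rightarrow> real" and z :: "'m::finite \<Rightarrow> real ^ 'n"
  assumes f: "\<And>x. GDERIV f x :> grad x"
    and hess: "\<And>x. (grad has_derivative (\<lambda>h. hess x *v h)) (at x)"
    and H: "\<And>x. l1_matrix (hess x) \<le> H"
    and z: "\<And>i j. \<bar>z i $ j\<bar> \<le> 1"
    and pos: "0 < H" "0 < \<sigma>" "0 < \<tau>"
    and sparse: "nnz (grad x) \<le> s"
    and cosamp: "cosamp_guarantee s \<rho> \<tau> (sensing_matrix z)"
    and n: "\<rho> ^ n * norm (grad x) \<le> \<tau> * sqrt (\<sigma> * H)"
    and step: "zoro_step f r \<sigma> s \<alpha> (2 * sqrt (\<sigma> / H)) n z x x'"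
  obtains g where "norm (g - grad x) \<le> 3 * \<tau> * sqrt (\<sigma> * H)" "x' = prox \<alpha> r (x - \<alpha> *\<^sub>R g)"
proof -
  let ?\<delta> = "2 * sqrt (\<sigma> / H)"
  obtain \<xi>0 \<xi> y g where \<xi>: "\<bar>\<xi>0\<bar> \<le> \<sigma>" "\<And>i. \<bar>\<xi> i\<bar> \<le> \<sigma>"
    and y: "y = (\<chi> i. 1 / sqrt (real CARD('m)) *
                 (((f (x + ?\<delta> *\<^sub>R z i) + \<xi> i) - (f x + \<xi>0)) / ?\<delta>))"
    and g: "cosamp_output s (sensing_matrix z) y n g"
    and x': "x' = prox \<alpha> r (x - \<alpha> *\<^sub>R g)"
    using step unfolding zoro_step_def by blast
  have "norm (g - grad x) \<le> \<tau> * norm (y - sensing_matrix z *v grad x) + \<rho> ^ n * norm (grad x)"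
    by (rule cosamp_error_of_sparse[OF cosamp sparse g])
  also have "\<dots> \<le> \<tau> * (2 * sqrt (\<sigma> * H)) + \<tau> * sqrt (\<sigma> * H)"
    unfolding y using pos
    by (intro add_mono mult_left_mono n measurement_error[OF f hess H z pos(1,2) \<xi> refl]) auto
  finally show ?thesis using x' by (intro that) auto
qed

section \<open>The random directions\<close>

text \<open>
  The law of the directions only makes them sign vectors almost surely, while the curvature bound
  needs the entries bounded by 1 at the given outcome; discarding a null set from the event \<open>S\<close>
  closes this gap.
\<close>

lemma rademacher_event:
  fixes z :: "'m::finite \<Rightarrow> 'w \<Rightarrow> real ^ 'n"
  assumes M: "prob_space M" and z: "iid_rademacher M z"
    and S: "S \<in> sets M"
  obtains A where "A \<in> sets M" "A \<subseteq> S" "measure M A = measure M S"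
    "\<And>\<omega> i j. \<omega> \<in> A \<Longrightarrow> \<bar>z i \<omega> $ j\<bar> \<le> 1"
proof -
  interpret prob_space M by (rule M)
  have meas: "(\<lambda>\<omega>. z i \<omega> $ j) \<in> borel_measurable M" for i j
  proof -
    have "indep_vars (\<lambda>_. borel) (\<lambda>(i, j) \<omega>. z i \<omega> $ j) UNIV"
      using z by (simp add: iid_rademacher_def)
    then have "(case (i, j) of (i, j) \<Rightarrow> \<lambda>\<omega>. z i \<omega> $ j) \<in> borel_measurable M"
      unfolding indep_vars_def by blast
    then show ?thesis by simp
  qed
  have "AE \<omega> in M. \<bar>z i \<omega> $ j\<bar> \<le> 1" for i j
  proof -
    let ?E = "\<lambda>c. {\<omega> \<in> space M. z i \<omega> $ j = c}"
    have E: "?E c \<in> events" for c using meas[of i j] by measurable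
    have "prob (?E 1 \<union> ?E (- 1)) = prob (?E 1) + prob (?E (- 1))"
      by (intro finite_measure_Union E) auto
    also have "\<dots> = 1 / 2 + 1 / 2" using z unfolding iid_rademacher_def by (metis (lifting))
    finally have "AE \<omega> in M. \<omega> \<in> ?E 1 \<union> ?E (- 1)"
      using E by (subst AE_in_set_eq_1) (simp_all add: sets.Un)
    then show ?thesis by eventually_elim auto
  qed
  then have ae: "AE \<omega> in M. \<forall>i j. \<bar>z i \<omega> $ j\<bar> \<le> 1"
    by (simp add: AE_all_countable)
  define A where "A = {\<omega> \<in> S. \<forall>i j. \<bar>z i \<omega> $ j\<bar> \<le> 1}"
  have "A = S \<inter> {\<omega> \<in> space M. \<forall>i j. \<bar>z i \<omega> $ j\<bar> \<le> 1}"
    using sets.sets_into_space[OF S] by (auto simp: A_def)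
  moreover have "{\<omega> \<in> space M. \<forall>i j. \<bar>z i \<omega> $ j\<bar> \<le> 1} \<in> sets M"
    using meas by measurable
  ultimately have A: "A \<in> sets M" using S by auto
  moreover have "measure M A = measure M S"
    using ae A S by (intro finite_measure_eq_AE) (auto simp: A_def)
  ultimately show ?thesis by (intro that[of A]) (auto simp: A_def)
qed

section \<open>Query complexity\<close>

theorem theorem1p11:
  fixes f :: "real ^ 'n \<Rightarrow> real"
    and grad :: "real ^ 'n \<Rightarrow> real ^ 'n"
    and hess :: "real ^ 'n \<Rightarrow> real ^ 'n ^ 'n"
    and r F :: "real ^ 'n \<Rightarrow> ereal"
    and Fstar e0 :: ereal
    and L H \<sigma> \<epsilon> \<rho> \<tau> b1 b2 :: real
    and s s_exact n :: nat
    and x0 :: "real ^ 'n"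
    and M :: "'w measure"
    and z :: "'m::finite \<Rightarrow> 'w \<Rightarrow> real ^ 'n"
  assumes f_diff: "\<And>x. GDERIV f x :> grad x"
    and f_diff2: "\<And>x. (grad has_derivative (\<lambda>h. hess x *v h)) (at x)"
    and r_ninf: "\<And>x. r x \<noteq> - \<infinity>"
    and r_convex: "convex_ext r"
    and r_prox: "proximable r"
    and F: "F = (\<lambda>x. ereal (f x) + r x)"
    and grad_sparse: "\<And>x. nnz (grad x) \<le> s_exact"
    and hess_sparse: "\<And>x. l1_matrix (hess x) \<le> H"
    and Fstar_min: "Fstar = (INF x. F x)" "\<exists>x. F x = Fstar" "\<bar>Fstar\<bar> \<noteq> \<infinity>"
    and grad_lipschitz: "\<And>x y. norm (grad x - grad y) \<le> L * norm (x - y)"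
    and pos: "0 < L" "0 < H" "0 < \<sigma>"
    and sparsity: "s_exact \<le> s" "1 \<le> s" "s \<le> CARD('n)"
    and m: "real CARD('m) = b1 * real s * ln (real CARD('n) / real s)"
    and rip_constants: "\<And>(N :: 'w measure) (u :: 'm \<Rightarrow> 'w \<Rightarrow> real ^ 'n).
          prob_space N \<Longrightarrow> iid_rademacher N u \<Longrightarrow>
          measure N {\<omega> \<in> space N. \<exists>\<delta>\<le>0.3843. rip (4 * s) \<delta> (sensing_matrix (\<lambda>i. u i \<omega>))}
            \<ge> 1 - 2 * (real s / real CARD('n)) powr (b2 * real s)"
    and cosamp_constants: "0 \<le> \<rho>" "\<rho> < 1" "0 < \<tau>"
          "\<And>Z :: real ^ 'n ^ 'm. \<exists>\<delta>\<le>0.3843. rip (4 * s) \<delta> Z \<Longrightarrow> cosamp_guarantee s \<rho> \<tau> Z"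
    and M: "prob_space M"
    and z: "iid_rademacher M z"
    and e0: "e0 = F x0 - Fstar"
    and eps: "\<epsilon> > b5 \<tau> * sqrt (\<sigma> * H)"
  shows "\<exists>A \<in> sets M.
           measure M A \<ge> 1 - 2 * (real s / real CARD('n)) powr (b2 * real s) \<and>
           (\<forall>\<omega>\<in>A. \<forall>x.
              zoro_run f r \<sigma> x0 s (1 / L) (2 * sqrt (\<sigma> / H)) n (\<lambda>i. z i \<omega>) x \<and>
              (\<forall>k. \<rho> ^ n * norm (grad (x k)) \<le> \<tau> * sqrt (\<sigma> * H)) \<longrightarrow>
              (\<exists>k. eps_stationary grad r \<epsilon> (x k) \<and>
                   (let budget = ereal (12 * b1 * L) * e0 * ereal (real s * ln (real CARD('n)))
                                   / ereal ((\<epsilon> - b5 \<tau> * sqrt (\<sigma> * H))\<^sup>2)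
                    in ereal (real (k * (CARD('m) + 1))) \<le> budget \<or> (k = 1 \<and> 0 < budget))))"
proof -
  let ?RIP = "{\<omega> \<in> space M. \<exists>\<delta>\<le>0.3843. rip (4 * s) \<delta> (sensing_matrix (\<lambda>i. z i \<omega>))}"
  let ?P = "1 - 2 * (real s / real CARD('n)) powr (b2 * real s)"
  have prob: "?P \<le> measure M ?RIP" by (rule rip_constants[OF M z])
  define \<eta> where "\<eta> = 3 * \<tau> * sqrt (\<sigma> * H)"
  define p where "p = \<epsilon> - 5 * \<eta>"
  have b5: "\<epsilon> - b5 \<tau> * sqrt (\<sigma> * H) = p" by (simp add: p_def \<eta>_def b5_def)
  have p: "0 < p" using eps b5 by simp
  have \<eta>: "0 \<le> \<eta>" using cosamp_constants(3) pos by (simp add: \<eta>_def)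
  have \<epsilon>: "5 * \<eta> < \<epsilon>" "0 < \<epsilon>" using p \<eta> by (auto simp: p_def)
  define c where "c = 3 * p\<^sup>2 / (8 * L)"
  have c: "0 < c" using p pos by (simp add: c_def)

  define W where "W = real s * ln (real CARD('n))"
  \<comment> \<open>As there is at least one measurement, the formula for \<open>m\<close> forces \<open>b1\<close> and \<open>ln d\<close> to be positive.\<close>
  have mb1: "0 < b1" "real CARD('m) \<le> b1 * W"
    "0 < W"
  proof -
    have s: "1 \<le> real s" "real s \<le> real CARD('n)" using sparsity by auto
    have "0 < real CARD('m)" by simp
    then have pos': "0 < b1 * (real s * ln (real CARD('n) / real s))"
      using m by (simp add: mult_ac)
    have ln0: "0 \<le> ln (real CARD('n) / real s)" using s by (intro ln_ge_zero) simp
    have "0 \<le> real s * ln (real CARD('n) / real s)" using ln0 by simp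
    then show b1: "0 < b1"
      using pos' mult_nonpos_nonneg[of b1 "real s * ln (real CARD('n) / real s)"] by linarith
    have le: "ln (real CARD('n) / real s) \<le> ln (real CARD('n))"
      using s by (simp add: ln_div)
    show "real CARD('m) \<le> b1 * W"
      unfolding m W_def mult.assoc using le b1 s by (intro mult_left_mono) auto
    then show "0 < W"
      using b1 \<open>0 < real CARD('m)\<close> by (meson less_le_trans zero_less_mult_pos)
  qed
  define budget where "budget = ereal (12 * b1 * L) * e0 * ereal W
      / ereal ((\<epsilon> - b5 \<tau> * sqrt (\<sigma> * H))\<^sup>2)"

  obtain Fs where Fs: "Fstar = ereal Fs" using Fstar_min(3) by (cases Fstar) auto
  have F_ge: "Fstar \<le> F y" for y unfolding Fstar_min(1) by (rule INF_lower) simp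
  have r_dom: "r y \<noteq> \<infinity> \<longleftrightarrow> F y \<noteq> \<infinity>" for y using r_ninf[of y] by (cases "r y") (auto simp: F)
  obtain y0 where y0: "r y0 \<noteq> \<infinity>" using Fstar_min(2) Fs r_dom by (metis PInfty_neq_ereal(1))

  \<comment> \<open>The deterministic part: a good outcome \<open>\<omega>\<close> and an arbitrary run, whatever its noise.\<close>
  have key: "\<exists>k. eps_stationary grad r \<epsilon> (x k) \<and>
      (ereal (real (k * (CARD('m) + 1))) \<le> budget \<or> (k = 1 \<and> 0 < budget))"
    if rip: "\<exists>\<delta>\<le>0.3843. rip (4 * s) \<delta> (sensing_matrix (\<lambda>i. z i \<omega>))"
      and bound: "\<And>i j. \<bar>z i \<omega> $ j\<bar> \<le> 1"
      and run: "zoro_run f r \<sigma> x0 s (1 / L) (2 * sqrt (\<sigma> / H)) n (\<lambda>i. z i \<omega>) x"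
      and n: "\<And>k. \<rho> ^ n * norm (grad (x k)) \<le> \<tau> * sqrt (\<sigma> * H)"
    for \<omega> x
  proof -
    let ?stat = "\<lambda>k. eps_stationary grad r \<epsilon> (x k)"
    have x0: "x 0 = x0" using run by (simp add: zoro_run_def)
    have step: "F (x (Suc k)) \<noteq> \<infinity> \<and> (\<not> ?stat (Suc k) \<longrightarrow> F (x (Suc k)) + ereal c \<le> F (x k))" for k
    proof -
      have sparse: "nnz (grad (x k)) \<le> s" using grad_sparse sparsity(1) order_trans by blast
      obtain g where g: "norm (g - grad (x k)) \<le> \<eta>"
        and x': "x (Suc k) = prox (1 / L) r (x k - (1 / L) *\<^sub>R g)"
        using zoro_step_inexact_prox[OF f_diff f_diff2 hess_sparse bound pos(2,3) cosamp_constants(3)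
            sparse cosamp_constants(4)[OF rip] n] run
        unfolding \<eta>_def zoro_run_def by blast
      have L: "0 < 1 / L" using pos by simp
      have "L *\<^sub>R (x k - x (Suc k)) - g \<in> subdiff r (x (Suc k))"
        using prox_subgradient[OF r_prox r_convex r_ninf y0 L, of "x k - (1 / L) *\<^sub>R g"] pos
        by (simp add: x'[symmetric] algebra_simps)
      from inexact_prox_gradient_descent[OF f_diff grad_lipschitz pos(1) this g \<epsilon>(1)]
      have "\<not> ?stat (Suc k) \<Longrightarrow> F (x (Suc k)) + ereal c \<le> F (x k)"
        by (simp add: F c_def p_def)
      moreover have "F (x (Suc k)) \<noteq> \<infinity>"
        using prox_finite[OF r_prox L y0 r_ninf] r_dom x' by simp
      ultimately show ?thesis by blast
    qed
    define a where "a k = real_of_ereal (F (x k))" for k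
    have a: "F (x k) = ereal (a k)" if "F (x k) \<noteq> \<infinity>" for k
      using that F_ge[of "x k"] Fs by (cases "F (x k)") (auto simp: a_def)
    have descent: "a (Suc k) + c \<le> a k" if "F (x k) \<noteq> \<infinity>" "\<not> ?stat (Suc k)" for k
      using step[of k] a[of k] a[of "Suc k"] that by simp
    have a_ge: "Fs \<le> a k" if "F (x k) \<noteq> \<infinity>" for k
      using a[OF that] F_ge[of "x k"] Fs by simp
    consider "F x0 = \<infinity>" | "F x0 = Fstar" | "F x0 \<noteq> \<infinity>" "Fstar < F x0"
      using F_ge[of x0] by fastforce
    then show ?thesis
    proof cases
      \<comment> \<open>Descent can only be counted from \<open>x 1\<close> on, which suffices for an infinite budget.\<close>
      case 1
      then have "budget = \<infinity>"
        using e0 Fs p mb1 pos by (simp add: budget_def b5)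
      moreover obtain k where "?stat (Suc (Suc k))"
        using exists_good_index_of_descent[of c Fs "\<lambda>k. a (Suc k)" "\<lambda>k. ?stat (Suc k)"]
          c a_ge descent step by blast
      ultimately show ?thesis by auto
    next
      case 2
      have "- (1 / 1) *\<^sub>R grad x0 \<in> subdiff r x0"
      proof (rule minimizer_imp_subgradient[OF f_diff r_convex r_ninf])
        show "r x0 \<noteq> \<infinity>" using 2 Fs r_dom by simp
        show "ereal (f x0) + ereal 1 * r x0 \<le> ereal (f y) + ereal 1 * r y" for y
          using F_ge[of y] 2 by (simp add: F flip: one_ereal_def)
      qed simp
      then have "0 \<in> {grad x0 + v |v. v \<in> subdiff r x0}" by force
      then have "?stat 0"
        using \<epsilon>(2) unfolding eps_stationary_def x0 by (intro bexI[of _ 0]) auto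
      moreover have "0 \<le> budget"
        using e0 2 Fs by (simp add: budget_def zero_ereal_def)
      ultimately show ?thesis by (intro exI[of _ 0]) (simp add: zero_ereal_def)
    next
      case 3
      then have fin: "F (x k) \<noteq> \<infinity>" for k using step x0 by (cases k) auto
      define E where "E = a 0 - Fs"
      have E: "0 < E" "e0 = ereal E"
        using 3(2) e0 Fs a[OF fin, of 0] by (auto simp: E_def x0)
      have bud: "budget = ereal (12 * b1 * L * E * W / p\<^sup>2)"
        using p by (simp add: budget_def b5 E(2))
      have bud0: "0 < budget" using mb1 pos E p by (simp add: bud)
      obtain k where k: "?stat (Suc k)" "real k * c \<le> E"
        using exists_good_index_of_descent[of c Fs a ?stat] c a_ge descent fin
        unfolding E_def by blast
      \<comment> \<open>The stationary iterate is \<open>x (Suc k)\<close>, so \<open>k = 0\<close> is the case of a single iteration.\<close>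
      show ?thesis
      proof (cases "k = 0")
        case True
        then show ?thesis using k(1) bud0 by auto
      next
        case False
        let ?m = "real CARD('m)"
        have "1 \<le> ?m" by (simp add: Suc_leI)
        have "real (Suc k * (CARD('m) + 1)) = (real k + 1) * (?m + 1)" by (simp add: algebra_simps)
        also have "\<dots> \<le> (2 * real k) * (2 * ?m)"
          using False \<open>1 \<le> ?m\<close> by (intro mult_mono) auto
        also have "\<dots> = 4 * ?m * (real k * c) / c" using c by simp
        also have "\<dots> \<le> 4 * ?m * E / c"
          using k(2) c by (intro divide_right_mono mult_left_mono) auto
        also have "\<dots> = (32 / 3) * (?m * (L * E / p\<^sup>2))"
          using p pos by (simp add: c_def field_simps)
        also have "\<dots> \<le> 12 * ((b1 * W) * (L * E / p\<^sup>2))"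
          using mb1 pos E by (intro mult_mono) auto
        finally have "ereal (real (Suc k * (CARD('m) + 1))) \<le> budget"
          by (simp add: bud mult_ac)
        then show ?thesis using k(1) by blast
      qed
    qed
  qed

  show ?thesis
  proof (cases "?RIP \<in> sets M")
    case True
    obtain A where A: "A \<in> sets M" "A \<subseteq> ?RIP" "measure M A = measure M ?RIP"
      "\<And>\<omega> i j. \<omega> \<in> A \<Longrightarrow> \<bar>z i \<omega> $ j\<bar> \<le> 1"
      using rademacher_event[OF M z True] by blast
    show ?thesis
      unfolding Let_def W_def[symmetric] budget_def[symmetric]
    proof (intro bexI[of _ A] conjI ballI allI impI)
      fix \<omega> x
      assume "\<omega> \<in> A" and x: "zoro_run f r \<sigma> x0 s (1 / L) (2 * sqrt (\<sigma> / H)) n (\<lambda>i. z i \<omega>) x \<and>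
          (\<forall>k. \<rho> ^ n * norm (grad (x k)) \<le> \<tau> * sqrt (\<sigma> * H))"
      then have "\<exists>\<delta>\<le>0.3843. rip (4 * s) \<delta> (sensing_matrix (\<lambda>i. z i \<omega>))" using A(2) by blast
      from key[OF this A(4)[OF \<open>\<omega> \<in> A\<close>]] x
      show "\<exists>k. eps_stationary grad r \<epsilon> (x k) \<and>
          (ereal (real (k * (CARD('m) + 1))) \<le> budget \<or> k = 1 \<and> 0 < budget)"
        by blast
    qed (use A prob in auto)
  next
    \<comment> \<open>A set that is not an event has measure 0 by convention, so in this case the
      probability claimed is at most 0 and the empty event attains it.\<close>
    case False
    then have "?P \<le> 0" using prob by (simp add: measure_notin_sets)
    then show ?thesis by (intro bexI[of _ "{}"]) auto
  qed
qed

end
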